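(* Let $G$ be a finite group and let $\chi$ be a character of $G$ afforded by a cyclic $\mathbb{C}G$-module. Then for all $\pi\in\operatorname{Sym}(G,\chi)$, $$\widehat{\chi}(\pi)=\frac{1}{|G|}\sum_{g\in G}\chi\big(g^{-1}\pi(g)\big).$$
   Context: For a $\mathbb{C}G$-module $V$, $\operatorname{Gens}(V)=\{v\in V: V=\mathbb{C}Gv\}$ and $V$ is cyclic if this set is nonempty. For $v\in V$, $\operatorname{Sym}(G,v)$ is the set of permutations $\pi$ of the set $G$ for which there is $A\in\operatorname{GL}(V)$ with $A(gv)=\pi(g)v$ for all $g\in G$; $\operatorname{Sym}(G,V)=\bigcap_{v\in\operatorname{Gens}(V)}\operatorname{Sym}(G,v)$. For $v\in \operatorname{Gens}(V)$ and $\pi\in\operatorname{Sym}(G,V)$, $D_v(\pi)\in\operatorname{GL}(V)$ is the unique linear map with $D_v(\pi)gv=\pi(g)v$ for all $g\in G$; $D_v$ is a representation of $\operatorname{Sym}(G,V)$ on $V$. If $\chi$ is the character of the cyclic $\mathbb{C}G$-module $V$, set $\operatorname{Sym}(G,\chi):=\operatorname{Sym}(G,V)$ and let $\widehat{\chi}$ be the character of $D_v\colon\operatorname{Sym}(G,\chi)\to\operatorname{GL}(V)$ (it does not depend on the choice of $v\in\operatorname{Gens}(V)$ or of $V$ affording $\chi$). *)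

theory Defs
  imports Complex_Main "HOL-Algebra.Coset" "HOL-Combinatorics.Permutations"
begin

context vector_space
begin

definition GL :: "('b \<Rightarrow> 'b) set" where
  "GL = {A. Vector_Spaces.linear scale scale A \<and> bij A}"

text \<open>The trace of an endomorphism of a finite-dimensional space: the sum of the diagonal entries
  of its matrix with respect to some basis; the value does not depend on which basis is taken.\<close>

definition trace :: "('b \<Rightarrow> 'b) \<Rightarrow> 'a" where
  "trace f = (let B = (SOME B. independent B \<and> span B = UNIV)
              in \<Sum>b\<in>B. representation B (f b) b)"

end

text \<open>A finite-dimensional module over the complex group algebra of a finite group \<open>G\<close>. The underlying
  space is the whole type \<open>'v\<close>, with scalar multiplication \<open>scale\<close>; \<open>act g\<close> is the action of the
  group element \<open>g\<close>, from which the action of the group algebra arises by linear extension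
  (see \<open>alg_act\<close>).\<close>

locale group_algebra_module =
  group G + vector_space scale
  for G :: "('g, 'm) monoid_scheme" (structure)
    and scale :: "complex \<Rightarrow> 'v::ab_group_add \<Rightarrow> 'v"
    and act :: "'g \<Rightarrow> 'v \<Rightarrow> 'v" +
  assumes finite_carrier: "finite (carrier G)"
    and finite_dim: "\<exists>B. finite B \<and> span B = UNIV"
    and act_linear: "g \<in> carrier G \<Longrightarrow> Vector_Spaces.linear scale scale (act g)"
    and act_one: "act \<one> v = v"
    and act_mult: "g \<in> carrier G \<Longrightarrow> h \<in> carrier G \<Longrightarrow> act (g \<otimes> h) v = act g (act h v)"
begin

text \<open>The element \<open>\<Sum>g. a g \<cdot> g\<close> of the group algebra is given by its coefficient function \<open>a\<close>.\<close>

definition alg_act :: "('g \<Rightarrow> complex) \<Rightarrow> 'v \<Rightarrow> 'v" where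
  "alg_act a v = (\<Sum>g\<in>carrier G. scale (a g) (act g v))"

definition Gens :: "'v set" where
  "Gens = {v. range (\<lambda>a. alg_act a v) = UNIV}"

definition cyclic :: bool where
  "cyclic \<longleftrightarrow> Gens \<noteq> {}"

definition affords :: "('g \<Rightarrow> complex) \<Rightarrow> bool" where
  "affords \<chi> \<longleftrightarrow> (\<forall>g\<in>carrier G. \<chi> g = trace (act g))"

text \<open>Permutations of the group are functions that fix everything outside \<open>carrier G\<close>.\<close>

definition Sym_vec :: "'v \<Rightarrow> ('g \<Rightarrow> 'g) set" where
  "Sym_vec v = {\<pi>. \<pi> permutes carrier G \<and>
     (\<exists>A\<in>GL. \<forall>g\<in>carrier G. A (act g v) = act (\<pi> g) v)}"

definition Sym :: "('g \<Rightarrow> 'g) set" where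
  "Sym = (\<Inter>v\<in>Gens. Sym_vec v)"

definition D :: "'v \<Rightarrow> ('g \<Rightarrow> 'g) \<Rightarrow> 'v \<Rightarrow> 'v" where
  "D v \<pi> = (THE A. A \<in> GL \<and> (\<forall>g\<in>carrier G. A (act g v) = act (\<pi> g) v))"

text \<open>The character of the representation \<open>D v\<close>, for a generator \<open>v\<close>.\<close>

definition chi_hat :: "'v \<Rightarrow> ('g \<Rightarrow> 'g) \<Rightarrow> complex" where
  "chi_hat v \<pi> = trace (D v \<pi>)"

end

end

theory Submission
  imports Defs
begin

text \<open>Let \<open>z = (\<Sum>g. g\<inverse> \<pi>(g))\<close> in the group algebra. For every generator \<open>w\<close> the average
  \<open>c\<^sub>w = (\<Sum>g. g\<inverse> D\<^sub>w(\<pi>) g)\<close> commutes with \<open>G\<close>, has trace \<open>|G| tr D\<^sub>w(\<pi>)\<close>, and satisfies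
  \<open>z w = c\<^sub>w w\<close>; so the claim is \<open>tr z = tr c\<^sub>v\<close>. Differentiating \<open>z w = c\<^sub>w w\<close> at \<open>w = v\<close> shows that
  \<open>z - c\<^sub>v\<close> maps \<open>V\<close> into \<open>E v\<close>, where \<open>E = End\<^sub>G(V)\<close>. On \<open>E v \<cong> E\<close> it is the commutator
  \<open>d \<mapsto> d c\<^sub>v - c\<^sub>v d\<close>, which has trace zero.\<close>

section \<open>Linear algebra in abstract vector spaces\<close>

context vector_space
begin

interpretation endo: vector_space_pair scale scale ..

lemma finite_spanning_imp_finite_dimensional:
  assumes "finite B" "span B = UNIV"
  obtains C where "finite_dimensional_vector_space scale C"
proof -
  obtain C where C: "C \<subseteq> B" "independent C" "B \<subseteq> span C"
    using maximal_independent_subset .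
  have "span C = UNIV"
    using C(3) assms(2) span_mono[of B "span C"] by (simp add: span_span top.extremum_uniqueI)
  with C assms(1) have "finite_dimensional_vector_space scale C"
    by unfold_locales (auto intro: finite_subset)
  then show ?thesis by (rule that)
qed

section \<open>Eigenvalues and injectivity of perturbed identity maps\<close>

text \<open>Applying \<open>L - s\<close> to a vanishing combination kills the \<open>s\<close>-term
  and multiplies every other coefficient by \<open>t - s\<close>, which is nonzero; induction on
  \<open>T\<close> then applies. Eigenvectors are indexed by their eigenvalues.\<close>

lemma eigenvectors_independent:
  assumes lin: "Vector_Spaces.linear scale scale L" and "finite T"
    and eig: "\<And>t. t \<in> T \<Longrightarrow> x t \<noteq> 0 \<and> L (x t) = t *s x t"
    and "(\<Sum>t\<in>T. c t *s x t) = 0" "t \<in> T"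
  shows "c t = 0"
  using assms(2-)
proof (induction T arbitrary: c t rule: finite_induct)
  case (insert s T)
  have eigT: "\<And>t. t \<in> T \<Longrightarrow> x t \<noteq> 0 \<and> L (x t) = t *s x t" using insert.prems(1) by blast
  let ?S = "\<Sum>t\<in>insert s T. c t *s x t"
  have "0 = L ?S - s *s ?S"
    using insert.prems(2) endo.linear_0[OF lin] by simp
  also have "\<dots> = (\<Sum>t\<in>insert s T. c t *s L (x t)) - (\<Sum>t\<in>insert s T. s *s (c t *s x t))"
    by (simp only: endo.linear_sum[OF lin] endo.linear_scale[OF lin] scale_sum_right)
  also have "\<dots> = (\<Sum>t\<in>insert s T. (c t * (t - s)) *s x t)"
    unfolding sum_subtractf[symmetric]
    by (rule sum.cong) (use insert.prems(1) in \<open>auto simp: algebra_simps scale_left_diff_distrib\<close>)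
  also have "\<dots> = (\<Sum>t\<in>T. (c t * (t - s)) *s x t)"
    using insert.hyps by simp
  finally have "\<And>t. t \<in> T \<Longrightarrow> c t * (t - s) = 0"
    using insert.IH[OF eigT, of "\<lambda>t. c t * (t - s)"] by metis
  with insert.hyps(2) have T0: "\<And>t. t \<in> T \<Longrightarrow> c t = 0" by force
  with insert.prems(2) insert.hyps have "c s *s x s = 0" by simp
  with insert.prems(1)[of s] have "c s = 0" by simp
  with T0 insert.prems(3) show ?case by auto
qed simp

text \<open>One eigenvector chosen per eigenvalue gives an independent family, which is finite in
  finite dimension.\<close>

lemma finite_eigenvalues:
  assumes "finite B" "span B = UNIV" and lin: "Vector_Spaces.linear scale scale L"
  shows "finite {t. \<exists>x. x \<noteq> 0 \<and> L x = t *s x}"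
proof -
  let ?S = "{t. \<exists>x. x \<noteq> 0 \<and> L x = t *s x}"
  obtain C where "finite_dimensional_vector_space scale C"
    using finite_spanning_imp_finite_dimensional assms(1,2) by blast
  then interpret fd: finite_dimensional_vector_space scale C .
  obtain x where x: "\<And>t. t \<in> ?S \<Longrightarrow> x t \<noteq> 0 \<and> L (x t) = t *s x t"
    by (rule that[of "\<lambda>t. SOME x. x \<noteq> 0 \<and> L x = t *s x"]) (metis (mono_tags, lifting) mem_Collect_eq someI_ex)
  have inj: "inj_on x ?S"
  proof (rule inj_onI)
    fix s t assume st: "s \<in> ?S" "t \<in> ?S" "x s = x t"
    then have "s *s x s = t *s x s" using x by metis
    with x[OF st(1)] show "s = t" by simp
  qed
  have "independent (x ` ?S)"
    unfolding independent_explicit_module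
  proof (intro allI impI)
    fix U u y assume U: "finite U" "U \<subseteq> x ` ?S" "(\<Sum>v\<in>U. u v *s v) = 0" "y \<in> U"
    define T where "T = {t \<in> ?S. x t \<in> U}"
    have UT: "U = x ` T" using U(2) unfolding T_def by blast
    have injT: "inj_on x T" by (rule inj_on_subset[OF inj]) (auto simp: T_def)
    have finT: "finite T" using U(1) injT UT finite_imageD by blast
    obtain t where t: "t \<in> T" "y = x t" using U(4) UT by auto
    have "(\<Sum>t\<in>T. u (x t) *s x t) = 0"
      using U(3) unfolding UT by (simp add: sum.reindex[OF injT])
    with eigenvectors_independent[OF lin finT, of x "\<lambda>t. u (x t)" t] t x
    show "u y = 0" by (auto simp: T_def)
  qed
  then have "finite (x ` ?S)" by (rule fd.finiteI_independent)
  with inj show ?thesis by (rule finite_imageD[rotated])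
qed

text \<open>A nonzero \<open>d\<close> in the kernel of \<open>1 + t L\<close> forces
  \<open>t \<noteq> 0\<close> and is an eigenvector of \<open>L\<close> for \<open>-1/t\<close>, so
  the exceptional \<open>t\<close> come from the finitely many eigenvalues.\<close>

lemma finite_not_inj_perturbation:
  assumes "finite B" "span B = UNIV" and lin: "Vector_Spaces.linear scale scale L"
  shows "finite {t. \<not> inj (\<lambda>x. x + t *s L x)}"
proof (rule finite_subset)
  let ?S = "{t. \<exists>x. x \<noteq> 0 \<and> L x = t *s x}"
  show "finite ((\<lambda>t. - inverse t) ` ?S)"
    using finite_eigenvalues[OF assms] by simp
  show "{t. \<not> inj (\<lambda>x. x + t *s L x)} \<subseteq> (\<lambda>t. - inverse t) ` ?S"
  proof
    fix t assume "t \<in> {t. \<not> inj (\<lambda>x. x + t *s L x)}"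
    then obtain x y where xy: "x \<noteq> y" "x + t *s L x = y + t *s L y"
      by (auto simp: inj_def)
    define d where "d = x - y"
    have d: "d \<noteq> 0" "d + t *s L d = 0"
      using xy by (auto simp: d_def endo.linear_diff[OF lin] scale_right_diff_distrib algebra_simps)
    then have t: "t \<noteq> 0" by auto
    have "t *s L d = - d" using d(2) by (simp add: eq_neg_iff_add_eq_0 add.commute)
    then have "inverse t *s (t *s L d) = inverse t *s (- d)" by simp
    then have "L d = (- inverse t) *s d" using t by simp
    with d(1) have "- inverse t \<in> ?S" by blast
    then show "t \<in> (\<lambda>t. - inverse t) ` ?S"
      by (rule image_eqI[rotated]) (use t in simp)
  qed
qed

section \<open>Trace\<close>

text \<open>The choice inside \<open>trace\<close> does not mention \<open>f\<close>, so a single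
  basis serves all maps at once, and traces of different maps can be compared entry by
  entry.\<close>

lemma trace_obtain_basis:
  assumes "finite B" "span B = UNIV"
  obtains C where "finite C" "independent C" "span C = UNIV"
    "\<And>f. trace f = (\<Sum>b\<in>C. representation C (f b) b)"
proof -
  obtain C0 where "finite_dimensional_vector_space scale C0"
    using finite_spanning_imp_finite_dimensional assms(1,2) by blast
  then interpret fd: finite_dimensional_vector_space scale C0 .
  define C where "C = (SOME B. independent B \<and> span B = UNIV)"
  have C: "independent C \<and> span C = UNIV"
    unfolding C_def by (rule someI[of _ C0]) (simp add: fd.independent_Basis fd.span_Basis)
  show ?thesis
  proof (rule that[of C])
    show "finite C" using C fd.finiteI_independent by blast
    show "trace f = (\<Sum>b\<in>C. representation C (f b) b)" for f
      by (simp add: trace_def C_def Let_def)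
  qed (use C in auto)
qed

context
  fixes C assumes C: "finite C" "independent C" "span C = UNIV"
begin

lemma sum_representation_basis: "(\<Sum>b\<in>C. representation C x b *s b) = x"
  using C by (intro sum_representation_eq) auto

lemma representation_linear_expand:
  assumes "Vector_Spaces.linear scale scale f"
  shows "representation C (f x) c = (\<Sum>b\<in>C. representation C x b * representation C (f b) c)"
proof -
  have "f x = (\<Sum>b\<in>C. representation C x b *s f b)"
    by (subst sum_representation_basis[symmetric, of x])
      (simp only: endo.linear_sum[OF assms] endo.linear_scale[OF assms])
  then show ?thesis using C
    by (simp add: representation_sum representation_scale)
qed

end

lemma trace_comp_commute:
  assumes "finite B" "span B = UNIV"
    and f: "Vector_Spaces.linear scale scale f" and g: "Vector_Spaces.linear scale scale g"
  shows "trace (\<lambda>x. f (g x)) = trace (\<lambda>x. g (f x))"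
proof -
  obtain C where C: "finite C" "independent C" "span C = UNIV"
    and tr: "\<And>f. trace f = (\<Sum>b\<in>C. representation C (f b) b)"
    using trace_obtain_basis[OF assms(1,2)] by blast
  show ?thesis
    unfolding tr representation_linear_expand[OF C f, of "g _"]
      representation_linear_expand[OF C g, of "f _"]
    by (subst sum.swap) (simp add: mult.commute)
qed

lemma trace_sum:
  assumes "finite B" "span B = UNIV"
  shows "trace (\<lambda>x. \<Sum>i\<in>I. f i x) = (\<Sum>i\<in>I. trace (f i))"
proof -
  obtain C where C: "finite C" "independent C" "span C = UNIV"
    and tr: "\<And>f. trace f = (\<Sum>b\<in>C. representation C (f b) b)"
    using trace_obtain_basis[OF assms(1,2)] by blast
  show ?thesis
    unfolding tr using C by (simp add: representation_sum sum.swap[of _ C])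
qed

lemma trace_diff:
  assumes "finite B" "span B = UNIV"
  shows "trace (\<lambda>x. f x - g x) = trace f - trace g"
proof -
  obtain C where C: "finite C" "independent C" "span C = UNIV"
    and tr: "\<And>f. trace f = (\<Sum>b\<in>C. representation C (f b) b)"
    using trace_obtain_basis[OF assms(1,2)] by blast
  show ?thesis
    unfolding tr using C by (simp add: representation_diff sum_subtractf)
qed

end

section \<open>Cyclic modules over the group algebra\<close>

context group_algebra_module
begin

interpretation endo: vector_space_pair scale scale ..

abbreviation linear_endo :: "('v \<Rightarrow> 'v) \<Rightarrow> bool" where
  "linear_endo \<equiv> Vector_Spaces.linear scale scale"

lemma linear_endoI:
  "(\<And>x y. f (x + y) = f x + f y) \<Longrightarrow> (\<And>c x. f (scale c x) = scale c (f x)) \<Longrightarrow> linear_endo f"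
  by (simp add: Vector_Spaces.linear_iff vector_space_axioms)

section \<open>The endomorphism algebra and averaging over the group\<close>

text \<open>The algebra End_G(V) of module endomorphisms, called E below.\<close>

definition commutant :: "('v \<Rightarrow> 'v) set" where
  "commutant = {c. linear_endo c \<and> (\<forall>g\<in>carrier G. \<forall>x. c (act g x) = act g (c x))}"

text \<open>The averaging operator from End(V) to E, left unnormalised: on E it is multiplication by
  |G|.\<close>

definition conj_sum :: "('v \<Rightarrow> 'v) \<Rightarrow> 'v \<Rightarrow> 'v" where
  "conj_sum f x = (\<Sum>g\<in>carrier G. act (inv g) (f (act g x)))"

lemma commutant_linear: "c \<in> commutant \<Longrightarrow> linear_endo c"
  by (simp add: commutant_def)

lemma commutant_act: "c \<in> commutant \<Longrightarrow> g \<in> carrier G \<Longrightarrow> c (act g x) = act g (c x)"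
  by (simp add: commutant_def)

lemma commutant_scale: "c \<in> commutant \<Longrightarrow> (\<lambda>x. scale a (c x)) \<in> commutant"
  unfolding commutant_def
  by (auto intro!: endo.linear_compose_scale_right simp: endo.linear_scale[OF act_linear])

lemma commutant_diff: "c \<in> commutant \<Longrightarrow> d \<in> commutant \<Longrightarrow> (\<lambda>x. c x - d x) \<in> commutant"
  unfolding commutant_def
  by (auto intro!: endo.linear_compose_sub simp: endo.linear_diff[OF act_linear])

lemma commutant_add: "c \<in> commutant \<Longrightarrow> d \<in> commutant \<Longrightarrow> (\<lambda>x. c x + d x) \<in> commutant"
  unfolding commutant_def
  by (auto intro!: endo.linear_compose_add simp: endo.linear_add[OF act_linear])

lemma commutant_zero: "(\<lambda>x. 0) \<in> commutant"
  unfolding commutant_def by (auto intro!: linear_endoI simp: endo.linear_0[OF act_linear])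

lemma commutant_sum: "(\<And>i. i \<in> I \<Longrightarrow> c i \<in> commutant) \<Longrightarrow> (\<lambda>x. \<Sum>i\<in>I. c i x) \<in> commutant"
  by (induction I rule: infinite_finite_induct) (auto intro: commutant_zero commutant_add)

lemma commutant_comp: "c \<in> commutant \<Longrightarrow> d \<in> commutant \<Longrightarrow> (\<lambda>x. c (d x)) \<in> commutant"
  unfolding commutant_def
  by (auto intro!: linear_endoI simp: endo.linear_add endo.linear_scale)

lemma act_inv_act: "g \<in> carrier G \<Longrightarrow> act (inv g) (act g x) = x"
  by (simp add: act_one flip: act_mult)

lemma act_act_inv: "g \<in> carrier G \<Longrightarrow> act g (act (inv g) x) = x"
  by (simp add: act_one flip: act_mult)

lemma conj_sum_in_commutant:
  assumes f: "linear_endo f"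
  shows "conj_sum f \<in> commutant"
proof -
  have "conj_sum f (act h x) = act h (conj_sum f x)" if h: "h \<in> carrier G" for h x
  proof -
    have "conj_sum f (act h x) = (\<Sum>k\<in>carrier G. act h (act (inv k) (f (act k x))))"
      unfolding conj_sum_def
      \<comment> \<open>Substituting \<open>k = g \<otimes> h\<close> turns \<open>inv g\<close>
        into \<open>h \<otimes> inv k\<close>.\<close>
      by (rule sum.reindex_bij_witness[of _ "\<lambda>k. k \<otimes> inv h" "\<lambda>g. g \<otimes> h"])
        (use h in \<open>simp_all add: inv_mult_group m_assoc act_mult act_act_inv\<close>)
    also have "\<dots> = act h (conj_sum f x)"
      unfolding conj_sum_def by (simp add: endo.linear_sum[OF act_linear[OF h]])
    finally show ?thesis .
  qed
  moreover have "linear_endo (conj_sum f)"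
    unfolding conj_sum_def
    by (intro linear_endoI)
      (simp_all add: endo.linear_add[OF act_linear] endo.linear_add[OF f]
        endo.linear_scale[OF act_linear] endo.linear_scale[OF f] sum.distrib scale_sum_right)
  ultimately show ?thesis by (simp add: commutant_def)
qed

section \<open>Generators\<close>

text \<open>The group algebra orbit of \<open>v\<close> is a subspace that contains the group orbit
  and lies in its span. This makes generation accessible to linear algebra.\<close>

lemma Gens_iff_span: "v \<in> Gens \<longleftrightarrow> span ((\<lambda>g. act g v) ` carrier G) = UNIV" (is "_ \<longleftrightarrow> span ?O = UNIV")
proof
  assume v: "v \<in> Gens"
  have "alg_act a v \<in> span ?O" for a
    unfolding alg_act_def by (intro span_sum span_scale span_base imageI)
  then have "range (\<lambda>a. alg_act a v) \<subseteq> span ?O" by blast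
  with v show "span ?O = UNIV" by (auto simp: Gens_def)
next
  assume s: "span ?O = UNIV"
  have "subspace (range (\<lambda>a. alg_act a v))"
  proof (rule subspaceI)
    show "0 \<in> range (\<lambda>a. alg_act a v)"
      by (rule range_eqI[of _ _ "\<lambda>_. 0"]) (simp add: alg_act_def)
  next
    fix x y assume "x \<in> range (\<lambda>a. alg_act a v)" "y \<in> range (\<lambda>a. alg_act a v)"
    then obtain a b where "x = alg_act a v" "y = alg_act b v" by blast
    then have "x + y = alg_act (\<lambda>g. a g + b g) v"
      by (simp add: alg_act_def scale_left_distrib sum.distrib)
    then show "x + y \<in> range (\<lambda>a. alg_act a v)" by blast
  next
    fix c x assume "x \<in> range (\<lambda>a. alg_act a v)"
    then obtain a where "x = alg_act a v" by blast
    then have "scale c x = alg_act (\<lambda>g. c * a g) v"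
      by (simp add: alg_act_def scale_sum_right)
    then show "scale c x \<in> range (\<lambda>a. alg_act a v)" by blast
  qed
  moreover have "act g v = alg_act (\<lambda>h. if h = g then 1 else 0) v" if "g \<in> carrier G" for g
    using that finite_carrier by (simp add: alg_act_def if_distrib[of "\<lambda>a. scale a _"] sum.delta cong: if_cong)
  then have "?O \<subseteq> range (\<lambda>a. alg_act a v)" by blast
  ultimately have "span ?O \<subseteq> range (\<lambda>a. alg_act a v)" by (intro span_minimal)
  with s show "v \<in> Gens" by (auto simp: Gens_def)
qed

lemma linear_eq_on_orbit:
  assumes "v \<in> Gens" "linear_endo f" "linear_endo f'"
    and "\<And>g. g \<in> carrier G \<Longrightarrow> f (act g v) = f' (act g v)"
  shows "f = f'"
proof
  fix x
  have "x \<in> span ((\<lambda>g. act g v) ` carrier G)" using assms(1) by (simp add: Gens_iff_span)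
  then show "f x = f' x"
    by (rule endo.linear_eq_on[OF assms(2,3)]) (use assms(4) in auto)
qed

text \<open>Both maps are determined on the whole orbit of \<open>v\<close> by their value at
  \<open>v\<close>. Hence \<open>d \<mapsto> d v\<close> embeds E into V.\<close>

lemma commutant_eqI:
  assumes "v \<in> Gens" "c \<in> commutant" "d \<in> commutant" "c v = d v"
  shows "c = d"
  by (rule linear_eq_on_orbit[OF assms(1)]) (use assms in \<open>auto simp: commutant_linear commutant_act\<close>)

text \<open>Take a basis of V from the orbit of \<open>v\<close>, with
  \<open>b = act (\<gamma> b) v\<close>. Replacing \<open>v\<close> by \<open>v + t w\<close> moves
  \<open>b\<close> to \<open>(1 + t L) b\<close>, where \<open>L b = act (\<gamma> b) w\<close>.
  Whenever \<open>1 + t L\<close> is injective, the moved vectors still span V.\<close>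

lemma finite_perturbation_not_Gens:
  assumes v: "v \<in> Gens"
  shows "finite {t. v + scale t w \<notin> Gens}"
proof -
  obtain S where S: "finite S" "span S = UNIV" using finite_dim by blast
  obtain B where B: "B \<subseteq> (\<lambda>g. act g v) ` carrier G" "independent B" "(\<lambda>g. act g v) ` carrier G \<subseteq> span B"
    using maximal_independent_subset by blast
  have spanB: "span B = UNIV"
    using span_mono[OF B(3)] v by (simp add: Gens_iff_span span_span top.extremum_uniqueI)
  from B(1) have "\<forall>b\<in>B. \<exists>g. g \<in> carrier G \<and> act g v = b" by blast
  then obtain \<gamma> where \<gamma>: "\<And>b. b \<in> B \<Longrightarrow> \<gamma> b \<in> carrier G \<and> act (\<gamma> b) v = b" by metis
  obtain L where L: "linear_endo L" "\<And>b. b \<in> B \<Longrightarrow> L b = act (\<gamma> b) w"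
    using endo.linear_independent_extend[OF B(2), of "\<lambda>b. act (\<gamma> b) w"] by blast
  obtain C where "finite_dimensional_vector_space scale C"
    using finite_spanning_imp_finite_dimensional S by blast
  then interpret fd: finite_dimensional_vector_space scale C .
  interpret fdp: finite_dimensional_vector_space_pair scale C scale C ..
  have "v + scale t w \<in> Gens" if inj: "inj (\<lambda>x. x + scale t (L x))" for t
  proof -
    let ?f = "\<lambda>x. x + scale t (L x)"
    let ?O = "(\<lambda>g. act g (v + scale t w)) ` carrier G"
    have f: "linear_endo ?f"
      by (rule linear_endoI)
        (simp_all add: endo.linear_add[OF L(1)] endo.linear_scale[OF L(1)] scale_right_distrib algebra_simps)
    have "surj ?f" by (rule fdp.linear_injective_imp_surjective[OF f inj]) simp
    moreover have "?f ` span B = span (?f ` B)" by (rule endo.linear_span_image[OF f, symmetric])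
    moreover have "?f ` B \<subseteq> ?O"
    proof
      fix y assume "y \<in> ?f ` B"
      then obtain b where b: "b \<in> B" "y = ?f b" by blast
      then have "y = act (\<gamma> b) (v + scale t w)"
        using \<gamma>[OF b(1)] L(2)[OF b(1)]
        by (simp add: endo.linear_add[OF act_linear] endo.linear_scale[OF act_linear])
      with \<gamma>[OF b(1)] show "y \<in> ?O" by blast
    qed
    then have "span (?f ` B) \<subseteq> span ?O" by (rule span_mono)
    ultimately show ?thesis using spanB by (auto simp: Gens_iff_span)
  qed
  then have "{t. v + scale t w \<notin> Gens} \<subseteq> {t. \<not> inj (\<lambda>x. x + scale t (L x))}" by blast
  with finite_not_inj_perturbation[OF S L(1)] show ?thesis by (rule rev_finite_subset)
qed

text \<open>If \<open>Z\<close> agrees at every generator with some element of the commutant, then \<open>(Z v\<^sub>t - c v\<^sub>t) / t\<close>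
  along \<open>v\<^sub>t = v + t w\<close> is the constant \<open>Z w - c w\<close> and lies in the commutant orbit of \<open>v\<^sub>t\<close>
  for almost all \<open>t\<close>; the limit \<open>t \<rightarrow> 0\<close> is taken algebraically, since independence is an open condition.\<close>

lemma difference_in_commutant_orbit:
  assumes Z: "linear_endo Z"
    and gen: "\<And>w. w \<in> Gens \<Longrightarrow> \<exists>c\<in>commutant. Z w = c w"
    and v: "v \<in> Gens" and c: "c \<in> commutant" "Z v = c v"
  shows "\<exists>d\<in>commutant. Z w - c w = d v"
proof (rule ccontr)
  define u where "u = Z w - c w"
  define E where "E = (\<lambda>d. d v) ` commutant"
  assume "\<not> (\<exists>d\<in>commutant. Z w - c w = d v)"
  then have uE: "u \<notin> E" by (auto simp: u_def E_def)
  have subE: "subspace E"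
    unfolding E_def
    by (rule subspaceI)
      (auto intro: image_eqI[OF _ commutant_zero] image_eqI[OF _ commutant_add] image_eqI[OF _ commutant_scale])
  obtain B where B: "B \<subseteq> E" "independent B" "E \<subseteq> span B"
    using maximal_independent_subset by blast
  have spanB: "span B = E" using B(1,3) subE by (simp add: span_minimal subset_antisym)
  have uB: "u \<notin> B" using B(1) uE by blast
  have indep: "independent (insert u B)" using B(2) uE spanB by (simp add: independent_insertI)
  from B(1) have "\<forall>b\<in>B. \<exists>e. e \<in> commutant \<and> e v = b" by (auto simp: E_def)
  then obtain e where e: "\<And>b. b \<in> B \<Longrightarrow> e b \<in> commutant \<and> e b v = b" by metis
  \<comment> \<open>\<open>L\<close> is built to send \<open>d v\<close> to \<open>d w\<close> for
    \<open>d\<close> in E and to kill \<open>u\<close>. Then \<open>1 + t L\<close> maps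
    \<open>d v\<close> to \<open>d (v + t w)\<close> and fixes \<open>u\<close>.\<close>
  obtain L where L: "linear_endo L" "\<And>b. b \<in> insert u B \<Longrightarrow> L b = (if b = u then 0 else e b w)"
    using endo.linear_independent_extend[OF indep, of "\<lambda>b. if b = u then 0 else e b w"] by blast
  have ex: "\<exists>d\<in>commutant. x = d v \<and> L x = d w" if "x \<in> span B" for x
    using that
  proof (induction rule: span_induct_alt)
    case base
    show ?case by (rule bexI[OF _ commutant_zero]) (simp add: endo.linear_0[OF L(1)])
  next
    case (step a b y)
    then obtain d where d: "d \<in> commutant" "y = d v" "L y = d w" by blast
    have eb: "e b \<in> commutant" "e b v = b" using e step.hyps(1) by auto
    have Lb: "L b = e b w" using L(2)[of b] step.hyps(1) uB by auto
    show ?case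
      by (rule bexI[OF _ commutant_add[OF commutant_scale[OF eb(1), of a] d(1)]])
        (simp add: eb(2) d(2)[symmetric] d(3) Lb endo.linear_add[OF L(1)] endo.linear_scale[OF L(1)])
  qed
  \<comment> \<open>Since \<open>d v\<close> determines \<open>d\<close>, the witness supplied by
    \<open>ex\<close> must be \<open>d\<close> itself.\<close>
  have Ld: "L (d v) = d w" if d: "d \<in> commutant" for d
  proof -
    have "d v \<in> span B" using d spanB by (auto simp: E_def)
    with ex obtain d' where d': "d' \<in> commutant" "d v = d' v" "L (d v) = d' w" by blast
    have "d = d'" by (rule commutant_eqI[OF v d d'(1,2)])
    with d'(3) show ?thesis by simp
  qed
  obtain S where S: "finite S" "span S = UNIV" using finite_dim by blast
  \<comment> \<open>A good \<open>t\<close> can be divided by, keeps \<open>v + t w\<close> a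
    generator and makes \<open>1 + t L\<close> injective; only finitely many \<open>t\<close>
    fail.\<close>
  let ?bad = "{0} \<union> {t. v + scale t w \<notin> Gens} \<union> {t. \<not> inj (\<lambda>x. x + scale t (L x))}"
  have "finite ?bad"
    using finite_perturbation_not_Gens[OF v] finite_not_inj_perturbation[OF S L(1)] by simp
  from ex_new_if_finite[OF infinite_UNIV_char_0 this] obtain t where "t \<notin> ?bad" ..
  then have t: "t \<noteq> 0" "v + scale t w \<in> Gens" "inj (\<lambda>x. x + scale t (L x))" by simp_all
  obtain d where d: "d \<in> commutant" "Z (v + scale t w) = d (v + scale t w)" using gen[OF t(2)] by blast
  \<comment> \<open>The difference quotient of the commutant elements at \<open>v + t w\<close> and
    at \<open>v\<close>; it satisfies \<open>u = k (v + t w)\<close>.\<close>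
  define k where "k = (\<lambda>x. scale (inverse t) (d x - c x))"
  have k: "k \<in> commutant" unfolding k_def by (intro commutant_scale commutant_diff d c)
  have "Z (v + scale t w) - c (v + scale t w) = scale t u"
    using c(2) by (simp add: u_def endo.linear_add[OF Z] endo.linear_scale[OF Z]
        endo.linear_add[OF commutant_linear[OF c(1)]] endo.linear_scale[OF commutant_linear[OF c(1)]]
        scale_right_diff_distrib)
  then have "u = k (v + scale t w)" using t(1) d(2) by (simp add: k_def)
  also have "\<dots> = k v + scale t (L (k v))"
    by (simp add: Ld[OF k] endo.linear_add[OF commutant_linear[OF k]] endo.linear_scale[OF commutant_linear[OF k]])
  \<comment> \<open>Both \<open>k v\<close> and \<open>u\<close> are sent to \<open>u\<close> by
    \<open>1 + t L\<close>, so injectivity puts \<open>u\<close> into \<open>E\<close>.\<close>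
  finally have "(\<lambda>x. x + scale t (L x)) (k v) = (\<lambda>x. x + scale t (L x)) u"
    using L(2)[of u] by simp
  with t(3) have "k v = u" by (rule injD)
  with k uE show False by (auto simp: E_def)
qed

section \<open>Comparison of traces through the commutator\<close>

text \<open>Left and right multiplication by \<open>c\<close> on the commutant \<open>E\<close> have equal trace:
  transported to \<open>End V\<close> by the averaging projection, both traces are
  \<open>\<Sum>g. tr (g\<inverse>) tr (g c)\<close> up to the factor \<open>|G|\<close>.\<close>

lemma trace_eq_commutant_trace:
  assumes Z: "linear_endo Z" and Zcomm: "\<And>d x. d \<in> commutant \<Longrightarrow> Z (d x) = d (Z x)"
    and v: "v \<in> Gens" and c: "c \<in> commutant" "Z v = c v"
    and orb: "\<And>w. \<exists>d\<in>commutant. Z w - c w = d v"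
  shows "trace Z = trace c"
proof -
  note clin = commutant_linear[OF c(1)]
  obtain S where S: "finite S" "span S = UNIV" using finite_dim by blast
  obtain C where C: "finite C" "independent C" "span C = UNIV"
    and tr: "\<And>f. trace f = (\<Sum>b\<in>C. representation C (f b) b)"
    using trace_obtain_basis[OF S] by blast
  define co where "co b x = representation C x b" for b x
  note expand = representation_linear_expand[OF C, folded co_def]
  have co_scale: "co b (scale a x) = a * co b x" for a b x
    using C by (simp add: co_def representation_scale)
  have co_sum: "co b (\<Sum>i\<in>I. f i) = (\<Sum>i\<in>I. co b (f i))" for b and f :: "'i \<Rightarrow> 'v" and I
    using C by (simp add: co_def representation_sum)
  have co_diff: "co b (x - y) = co b x - co b y" for b x y
    using C by (simp add: co_def representation_diff)
  have co_add: "co b (x + y) = co b x + co b y" for b x y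
    using C by (simp add: co_def representation_add)
  have tr: "trace f = (\<Sum>b\<in>C. co b (f b))" for f by (simp add: tr co_def)
  \<comment> \<open>Matrix units: for \<open>i\<close>, \<open>j\<close> in the basis
    \<open>C\<close>, \<open>X i j\<close> sends \<open>j\<close> to \<open>i\<close> and the other
    basis vectors to 0. Their averages \<open>P i j\<close> lie in E.\<close>
  define X where "X i j = (\<lambda>x. scale (co j x) i)" for i j
  have X: "linear_endo (X i j)" for i j
    unfolding X_def by (rule linear_endoI) (simp_all add: co_add co_scale scale_left_distrib)
  define P where "P i j = conj_sum (X i j)" for i j
  have P: "P i j \<in> commutant" for i j unfolding P_def by (rule conj_sum_in_commutant[OF X])
  have P_eq: "P i j x = (\<Sum>g\<in>carrier G. scale (co j (act g x)) (act (inv g) i))" for i j x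
    unfolding P_def conj_sum_def X_def
    by (rule sum.cong) (simp_all add: endo.linear_scale[OF act_linear])
  from orb obtain d where d: "\<And>w. d w \<in> commutant" "\<And>w. Z w - c w = d w v" by metis
  define M where "M = (\<lambda>x. Z x - c x)"
  have M: "linear_endo M" unfolding M_def by (rule endo.linear_compose_sub[OF Z clin])
  \<comment> \<open>Both sides lie in E, so comparing them at \<open>v\<close> suffices. There
    \<open>c v = Z v\<close>, and \<open>Z\<close> commutes with \<open>P i j\<close>, so the
    commutator becomes \<open>M (P i j v)\<close>; it is expanded in the basis using
    \<open>M k = d k v\<close>.\<close>
  have key: "P i j (c x) - c (P i j x) = (\<Sum>k\<in>C. scale (co k (P i j v)) (d k x))" for i j x
  proof -
    have "(\<lambda>x. P i j (c x) - c (P i j x)) = (\<lambda>x. \<Sum>k\<in>C. scale (co k (P i j v)) (d k x))"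
    proof (rule commutant_eqI[OF v])
      show "(\<lambda>x. P i j (c x) - c (P i j x)) \<in> commutant"
        by (rule commutant_diff[OF commutant_comp[OF P c(1)] commutant_comp[OF c(1) P]])
      show "(\<lambda>x. \<Sum>k\<in>C. scale (co k (P i j v)) (d k x)) \<in> commutant"
        by (rule commutant_sum, rule commutant_scale, rule d(1))
      have "P i j (c v) - c (P i j v) = M (P i j v)"
        by (simp add: M_def Zcomm[OF P] c(2))
      also have "\<dots> = M (\<Sum>k\<in>C. scale (co k (P i j v)) k)"
        unfolding co_def by (simp add: sum_representation_basis[OF C])
      also have "\<dots> = (\<Sum>k\<in>C. scale (co k (P i j v)) (M k))"
        by (simp add: endo.linear_sum[OF M] endo.linear_scale[OF M])
      finally show "P i j (c v) - c (P i j v) = (\<Sum>k\<in>C. scale (co k (P i j v)) (d k v))"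
        by (simp add: M_def d(2))
    qed
    then show ?thesis by meson
  qed
  \<comment> \<open>The trace, on End(V) with basis \<open>X i j\<close>, of the map sending
    \<open>T\<close> to the commutator of \<open>conj_sum T\<close> with \<open>c\<close>. It is
    evaluated twice: as 0, and as |G| times the trace of \<open>M\<close>.\<close>
  define \<Sigma> where "\<Sigma> = (\<Sum>i\<in>C. \<Sum>j\<in>C. co i (P i j (c j) - c (P i j j)))"
  have "\<Sigma> = (\<Sum>g\<in>carrier G. trace (\<lambda>x. act g (c x)) * trace (act (inv g)))
      - (\<Sum>g\<in>carrier G. trace (act g) * trace (\<lambda>x. c (act (inv g) x)))"
  proof -
    \<comment> \<open>By \<open>P_eq\<close> each summand is a coordinate indexed by
      \<open>j\<close> times one indexed by \<open>i\<close>, so for each \<open>g\<close> the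
      double sum factors into two traces.\<close>
    have 1: "(\<Sum>i\<in>C. \<Sum>j\<in>C. co i (P i j (c j)))
      = (\<Sum>g\<in>carrier G. trace (\<lambda>x. act g (c x)) * trace (act (inv g)))"
      unfolding P_eq co_sum co_scale tr sum_product
      by (subst (2) sum.swap, subst sum.swap, intro sum.cong refl, subst sum.swap, rule refl)
    have 2: "(\<Sum>i\<in>C. \<Sum>j\<in>C. co i (c (P i j j)))
      = (\<Sum>g\<in>carrier G. trace (act g) * trace (\<lambda>x. c (act (inv g) x)))"
      unfolding P_eq endo.linear_sum[OF clin] endo.linear_scale[OF clin] co_sum co_scale tr sum_product
      by (subst (2) sum.swap, subst sum.swap, intro sum.cong refl, subst sum.swap, rule refl)
    show ?thesis unfolding \<Sigma>_def co_diff sum_subtractf 1 2 ..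
  qed
  \<comment> \<open>Replace \<open>g\<close> by its inverse and use that \<open>c\<close> commutes
    with the action.\<close>
  also have "(\<Sum>g\<in>carrier G. trace (act g) * trace (\<lambda>x. c (act (inv g) x)))
      = (\<Sum>g\<in>carrier G. trace (\<lambda>x. act g (c x)) * trace (act (inv g)))"
    by (rule sum.reindex_bij_witness[of _ "m_inv G" "m_inv G"])
      (simp_all add: commutant_act[OF c(1)] mult.commute)
  finally have "\<Sigma> = 0" by simp
  \<comment> \<open>Second evaluation, through \<open>key\<close>.\<close>
  have "\<Sigma> = (\<Sum>i\<in>C. \<Sum>j\<in>C. \<Sum>k\<in>C. co k (P i j v) * co i (d k j))"
    by (simp add: \<Sigma>_def key co_sum co_scale)
  also have "\<dots> = (\<Sum>k\<in>C. \<Sum>i\<in>C. \<Sum>j\<in>C. co k (P i j v) * co i (d k j))"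
    by (subst (2) sum.swap, subst sum.swap, rule refl)
  \<comment> \<open>For fixed \<open>k\<close>, the numbers \<open>co i (d k j)\<close> are the
    matrix entries of \<open>d k\<close>. Summing them against \<open>P i j\<close> rebuilds
    \<open>conj_sum (d k)\<close>, of which the \<open>k\<close>-coordinate at \<open>v\<close>
    remains.\<close>
  also have "\<dots> = (\<Sum>k\<in>C. \<Sum>g\<in>carrier G. co k (act (inv g) (d k (act g v))))"
  proof (rule sum.cong[OF refl])
    fix k
    have "(\<Sum>i\<in>C. \<Sum>j\<in>C. co k (P i j v) * co i (d k j))
      = (\<Sum>i\<in>C. \<Sum>j\<in>C. \<Sum>g\<in>carrier G. co j (act g v) * co k (act (inv g) i) * co i (d k j))"
      by (simp add: P_eq co_sum co_scale sum_distrib_right)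
    also have "\<dots> = (\<Sum>g\<in>carrier G. \<Sum>i\<in>C. \<Sum>j\<in>C. co j (act g v) * co k (act (inv g) i) * co i (d k j))"
      by (subst (2) sum.swap, subst sum.swap, rule refl)
    also have "\<dots> = (\<Sum>g\<in>carrier G. co k (act (inv g) (d k (act g v))))"
    proof (rule sum.cong[OF refl])
      fix g assume g: "g \<in> carrier G"
      have "co k (act (inv g) (d k (act g v)))
        = (\<Sum>i\<in>C. co i (d k (act g v)) * co k (act (inv g) i))"
        using g by (intro expand act_linear) simp
      also have "\<dots> = (\<Sum>i\<in>C. (\<Sum>j\<in>C. co j (act g v) * co i (d k j)) * co k (act (inv g) i))"
        by (simp only: expand[OF commutant_linear[OF d(1)], of _ _ "act g v"])
      also have "\<dots> = (\<Sum>i\<in>C. \<Sum>j\<in>C. co j (act g v) * co k (act (inv g) i) * co i (d k j))"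
        by (simp add: sum_distrib_left sum_distrib_right mult_ac)
      finally show "(\<Sum>i\<in>C. \<Sum>j\<in>C. co j (act g v) * co k (act (inv g) i) * co i (d k j))
        = co k (act (inv g) (d k (act g v)))" by simp
    qed
    finally show "(\<Sum>i\<in>C. \<Sum>j\<in>C. co k (P i j v) * co i (d k j))
      = (\<Sum>g\<in>carrier G. co k (act (inv g) (d k (act g v))))" .
  qed
  \<comment> \<open>As \<open>d k\<close> commutes with the action, each summand reduces to the
    \<open>k\<close>-coordinate of \<open>d k v = M k\<close>, a diagonal entry of
    \<open>M\<close>.\<close>
  also have "\<dots> = (\<Sum>k\<in>C. \<Sum>g\<in>carrier G. co k (M k))"
    by (intro sum.cong refl) (simp add: commutant_act[OF d(1)] act_inv_act M_def d(2))
  also have "\<dots> = of_nat (card (carrier G)) * trace M"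
    by (simp add: tr sum_distrib_left)
  finally have "of_nat (card (carrier G)) * trace M = 0" using \<open>\<Sigma> = 0\<close> by simp
  moreover have "card (carrier G) \<noteq> 0" using finite_carrier by (simp add: card_eq_0_iff carrier_not_empty)
  ultimately have "trace M = 0" by simp
  then show ?thesis unfolding M_def trace_diff[OF S] by simp
qed

section \<open>The trace of \<open>D v \<pi>\<close>\<close>

text \<open>Justifies the definite description: membership in \<open>Sym\<close> gives existence,
  and linear maps agreeing on the orbit of a generator coincide.\<close>

lemma D_properties:
  assumes v: "v \<in> Gens" and \<pi>: "\<pi> \<in> Sym"
  shows "linear_endo (D v \<pi>)" "\<And>g. g \<in> carrier G \<Longrightarrow> D v \<pi> (act g v) = act (\<pi> g) v"
proof -
  from v \<pi> obtain A where A: "A \<in> GL" "\<forall>g\<in>carrier G. A (act g v) = act (\<pi> g) v"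
    unfolding Sym_def Sym_vec_def by blast
  have "D v \<pi> \<in> GL \<and> (\<forall>g\<in>carrier G. D v \<pi> (act g v) = act (\<pi> g) v)"
    unfolding D_def
    by (rule theI[of _ A]) (use A in \<open>auto intro!: linear_eq_on_orbit[OF v] simp: GL_def\<close>)
  then show "linear_endo (D v \<pi>)" "\<And>g. g \<in> carrier G \<Longrightarrow> D v \<pi> (act g v) = act (\<pi> g) v"
    by (auto simp: GL_def)
qed

text \<open>Every summand is a conjugate of \<open>f\<close>, hence has the trace of
  \<open>f\<close>.\<close>

lemma trace_conj_sum:
  assumes f: "linear_endo f"
  shows "trace (conj_sum f) = of_nat (order G) * trace f"
proof -
  obtain S where S: "finite S" "span S = UNIV" using finite_dim by blast
  have "trace (conj_sum f) = (\<Sum>g\<in>carrier G. trace (\<lambda>x. act (inv g) (f (act g x))))"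
    unfolding conj_sum_def[abs_def] by (rule trace_sum[OF S])
  also have "\<dots> = (\<Sum>g\<in>carrier G. trace f)"
  proof (rule sum.cong[OF refl])
    fix g assume g: "g \<in> carrier G"
    have "linear_endo (\<lambda>x. f (act g x))"
      by (rule linear_endoI) (simp_all add: endo.linear_add[OF act_linear[OF g]] endo.linear_add[OF f]
        endo.linear_scale[OF act_linear[OF g]] endo.linear_scale[OF f])
    from trace_comp_commute[OF S act_linear[OF inv_closed[OF g]] this]
    show "trace (\<lambda>x. act (inv g) (f (act g x))) = trace f"
      by (simp add: act_act_inv[OF g])
  qed
  finally show ?thesis by (simp add: order_def)
qed

text \<open>As \<open>\<pi>\<close> lies in \<open>Sym_vec w\<close> for every generator
  \<open>w\<close>, each \<open>w\<close> has its own \<open>D w \<pi>\<close>, whose average agrees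
  with the fixed map \<open>Z\<close> at \<open>w\<close>. This feeds the perturbation argument, and
  \<open>trace Z\<close> is the right-hand side.\<close>

lemma trace_D_eq:
  assumes v: "v \<in> Gens" and \<pi>: "\<pi> \<in> Sym"
  shows "of_nat (order G) * trace (D v \<pi>) = (\<Sum>g\<in>carrier G. trace (act (inv g \<otimes> \<pi> g)))"
proof -
  obtain S where S: "finite S" "span S = UNIV" using finite_dim by blast
  from v \<pi> have "\<pi> permutes carrier G" by (auto simp: Sym_def Sym_vec_def)
  then have \<pi>G: "\<pi> g \<in> carrier G" if "g \<in> carrier G" for g
    using that by (simp add: permutes_in_image)
  define Z where "Z x = (\<Sum>g\<in>carrier G. act (inv g \<otimes> \<pi> g) x)" for x
  have Z: "linear_endo Z"
    unfolding Z_def[abs_def] using \<pi>G by (intro endo.linear_compose_sum ballI act_linear) simp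
  have B: "conj_sum (D w \<pi>) \<in> commutant" "Z w = conj_sum (D w \<pi>) w" if w: "w \<in> Gens" for w
  proof -
    show "conj_sum (D w \<pi>) \<in> commutant" by (rule conj_sum_in_commutant[OF D_properties(1)[OF w \<pi>]])
    \<comment> \<open>Termwise, \<open>act (\<pi> g) w\<close> is
      \<open>D w \<pi> (act g w)\<close>.\<close>
    show "Z w = conj_sum (D w \<pi>) w"
      unfolding Z_def conj_sum_def
      by (rule sum.cong) (simp_all add: D_properties(2)[OF w \<pi>] act_mult \<pi>G)
  qed
  have "trace Z = trace (conj_sum (D v \<pi>))"
  proof (rule trace_eq_commutant_trace[OF Z _ v B[OF v]])
    show "Z (d x) = d (Z x)" if "d \<in> commutant" for d x
      unfolding Z_def endo.linear_sum[OF commutant_linear[OF that]]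
      by (rule sum.cong) (simp_all add: commutant_act[OF that] \<pi>G)
    show "\<exists>d\<in>commutant. Z w - conj_sum (D v \<pi>) w = d v" for w
      by (rule difference_in_commutant_orbit[OF Z _ v B[OF v]]) (use B in blast)
  qed
  with trace_conj_sum[OF D_properties(1)[OF v \<pi>]] show ?thesis
    unfolding Z_def[abs_def] trace_sum[OF S] by simp
qed

end

theorem proposition5p9:
  fixes G :: "('g, 'm) monoid_scheme" (structure)
    and scale :: "complex \<Rightarrow> 'v::ab_group_add \<Rightarrow> 'v"
    and act :: "'g \<Rightarrow> 'v \<Rightarrow> 'v"
    and \<chi> :: "'g \<Rightarrow> complex"
  assumes "group_algebra_module G scale act"
    and "group_algebra_module.cyclic G scale act"
    and "group_algebra_module.affords G scale act \<chi>"
  shows "\<forall>v \<in> group_algebra_module.Gens G scale act.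
    \<forall>\<pi> \<in> group_algebra_module.Sym G scale act.
      group_algebra_module.chi_hat G scale act v \<pi> =
        (1 / of_nat (order G)) * (\<Sum>g\<in>carrier G. \<chi> (inv g \<otimes> \<pi> g))"
proof (intro ballI)
  interpret group_algebra_module G scale act by fact
  fix v \<pi> assume v: "v \<in> Gens" and \<pi>: "\<pi> \<in> Sym"
  \<comment> \<open>\<open>affords\<close> constrains \<open>\<chi>\<close> on the carrier only, so
    \<open>inv g \<otimes> \<pi> g\<close> has to lie there.\<close>
  from v \<pi> have "\<pi> permutes carrier G" by (auto simp: Sym_def Sym_vec_def)
  then have "(\<Sum>g\<in>carrier G. \<chi> (inv g \<otimes> \<pi> g)) = (\<Sum>g\<in>carrier G. trace (act (inv g \<otimes> \<pi> g)))"
    using assms(3) by (intro sum.cong refl) (simp add: affords_def permutes_in_image)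
  with trace_D_eq[OF v \<pi>]
  have "(\<Sum>g\<in>carrier G. \<chi> (inv g \<otimes> \<pi> g)) = of_nat (order G) * chi_hat v \<pi>"
    by (simp add: chi_hat_def)
  moreover have "order G \<noteq> 0" using finite_carrier order_gt_0_iff_finite by simp
  ultimately show "chi_hat v \<pi> = (1 / of_nat (order G)) * (\<Sum>g\<in>carrier G. \<chi> (inv g \<otimes> \<pi> g))"
    by simp
qed

end
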